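(* The class of coherent sober spaces is projective: if $(p_{ij}\colon X_j\to X_i)_{i\sqsubseteq j\in I}$ is a projective system of topological spaces in which every $X_i$ is coherent and sober, then every projective limit of this system in the category of topological spaces is coherent and sober.
   Context: A projective system of topological spaces consists of a directed preordered set $(I,\sqsubseteq)$, spaces $X_i$ and continuous maps $p_{ij}\colon X_j\to X_i$ for $i\sqsubseteq j$ with $p_{ii}=\mathrm{id}$ and $p_{ij}\circ p_{jk}=p_{ik}$; its projective limit is its limit in the category of topological spaces (canonically, the subspace of $\prod_i X_i$ of tuples $\vec x$ with $p_{ij}(x_j)=x_i$ for all $i\sqsubseteq j$). A subset is saturated if it equals the intersection of its open neighbourhoods (equivalently, it is upward closed in the specialization preorder $x\le y$ iff every open neighbourhood of $x$ contains $y$). Compactness assumes no separation axiom. A space is coherent if the intersection of any two compact saturated subsets is compact. A space is sober if it is $T_0$ and every irreducible closed subset (non-empty closed set not contained in the union of two closed sets unless contained in one of them) is the closure of a single point. *)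

theory Defs
  imports "HOL-Analysis.Analysis"
begin

definition saturated_in :: "'a topology \<Rightarrow> 'a set \<Rightarrow> bool" where
  "saturated_in X S \<longleftrightarrow> S \<subseteq> topspace X \<and>
     S = topspace X \<inter> \<Inter>{U. openin X U \<and> S \<subseteq> U}"

definition coherent_space :: "'a topology \<Rightarrow> bool" where
  "coherent_space X \<longleftrightarrow>
     (\<forall>K L. compactin X K \<and> saturated_in X K \<and> compactin X L \<and> saturated_in X L
        \<longrightarrow> compactin X (K \<inter> L))"

definition irreducible_closed_in :: "'a topology \<Rightarrow> 'a set \<Rightarrow> bool" where
  "irreducible_closed_in X C \<longleftrightarrow> closedin X C \<and> C \<noteq> {} \<and>
     (\<forall>A B. closedin X A \<and> closedin X B \<and> C \<subseteq> A \<union> B \<longrightarrow> C \<subseteq> A \<or> C \<subseteq> B)"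

definition sober_space :: "'a topology \<Rightarrow> bool" where
  "sober_space X \<longleftrightarrow> t0_space X \<and>
     (\<forall>C. irreducible_closed_in X C \<longrightarrow> (\<exists>x\<in>topspace X. C = X closure_of {x}))"

definition directed_preorder :: "'i set \<Rightarrow> ('i \<Rightarrow> 'i \<Rightarrow> bool) \<Rightarrow> bool" where
  "directed_preorder I le \<longleftrightarrow> I \<noteq> {} \<and>
     (\<forall>i\<in>I. le i i) \<and>
     (\<forall>i\<in>I. \<forall>j\<in>I. \<forall>k\<in>I. le i j \<and> le j k \<longrightarrow> le i k) \<and>
     (\<forall>i\<in>I. \<forall>j\<in>I. \<exists>k\<in>I. le i k \<and> le j k)"

definition projective_system ::
  "'i set \<Rightarrow> ('i \<Rightarrow> 'i \<Rightarrow> bool) \<Rightarrow> ('i \<Rightarrow> 'a topology) \<Rightarrow> ('i \<Rightarrow> 'i \<Rightarrow> 'a \<Rightarrow> 'a) \<Rightarrow> bool" where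
  "projective_system I le X p \<longleftrightarrow> directed_preorder I le \<and>
     (\<forall>i\<in>I. \<forall>j\<in>I. le i j \<longrightarrow> continuous_map (X j) (X i) (p i j)) \<and>
     (\<forall>i\<in>I. \<forall>x\<in>topspace (X i). p i i x = x) \<and>
     (\<forall>i\<in>I. \<forall>j\<in>I. \<forall>k\<in>I. le i j \<and> le j k \<longrightarrow>
        (\<forall>x\<in>topspace (X k). p i j (p j k x) = p i k x))"

definition canonical_proj_limit ::
  "'i set \<Rightarrow> ('i \<Rightarrow> 'i \<Rightarrow> bool) \<Rightarrow> ('i \<Rightarrow> 'a topology) \<Rightarrow> ('i \<Rightarrow> 'i \<Rightarrow> 'a \<Rightarrow> 'a) \<Rightarrow> ('i \<Rightarrow> 'a) topology" where
  "canonical_proj_limit I le X p =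
     subtopology (product_topology X I)
       {x \<in> topspace (product_topology X I). \<forall>i\<in>I. \<forall>j\<in>I. le i j \<longrightarrow> p i j (x j) = x i}"

text \<open>A cone (L, q) over the system is a projective limit (limit in Top) iff the
  induced comparison map into the canonical limit is a homeomorphism.\<close>
definition is_proj_limit ::
  "'i set \<Rightarrow> ('i \<Rightarrow> 'i \<Rightarrow> bool) \<Rightarrow> ('i \<Rightarrow> 'a topology) \<Rightarrow> ('i \<Rightarrow> 'i \<Rightarrow> 'a \<Rightarrow> 'a)
     \<Rightarrow> 'b topology \<Rightarrow> ('i \<Rightarrow> 'b \<Rightarrow> 'a) \<Rightarrow> bool" where
  "is_proj_limit I le X p L q \<longleftrightarrow>
     (\<forall>i\<in>I. continuous_map L (X i) (q i)) \<and>
     (\<forall>i\<in>I. \<forall>j\<in>I. le i j \<longrightarrow> (\<forall>y\<in>topspace L. p i j (q j y) = q i y)) \<and>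
     homeomorphic_map L (canonical_proj_limit I le X p) (\<lambda>y. restrict (\<lambda>i. q i y) I)"

end

theory Submission
  imports Defs
begin

text \<open>
  If \<open>K\<close> is compact saturated in the limit and \<open>K\<^sub>i\<close> is the saturation of its image in \<open>X\<^sub>i\<close>,
  then \<open>K\<close> is the intersection of the preimages of the \<open>K\<^sub>i\<close>. Hence the intersection of
  compact saturated sets \<open>K\<close> and \<open>M\<close> is the limit of the compact saturated sets \<open>Q\<^sub>i = K\<^sub>i \<inter> M\<^sub>i\<close>, and it
  remains to show that such a limit is compact (Steenrod's theorem). Given a cover without finite
  subcover, let \<open>W\<^sub>i\<close> be the union of the opens of \<open>X\<^sub>i\<close> whose preimages are finitely covered; it
  does not contain \<open>Q\<^sub>i\<close>. By Zorn's lemma there is a maximal family of opens extending \<open>W\<close>,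
  compatible with the bonding maps and with no member containing \<open>Q\<^sub>i\<close>. Maximality and directedness
  make the complements irreducible, and their generic points form a point of the limit that lies in
  all \<open>Q\<^sub>i\<close> and that the cover misses.
\<close>

section \<open>Saturations and compact saturated sets\<close>

text \<open>The factor \<open>topspace X\<close> matters only when \<open>S\<close> is not contained
  in it: then no open set contains \<open>S\<close>, and the empty intersection alone would be
  \<open>UNIV\<close>.\<close>

definition saturation_of :: "'a topology \<Rightarrow> 'a set \<Rightarrow> 'a set" where
  "saturation_of X S = topspace X \<inter> \<Inter>{U. openin X U \<and> S \<subseteq> U}"

lemma saturation_of_subset_open: "openin X U \<Longrightarrow> S \<subseteq> U \<Longrightarrow> saturation_of X S \<subseteq> U"
  unfolding saturation_of_def by auto

lemma subset_saturation_of: "S \<subseteq> topspace X \<Longrightarrow> S \<subseteq> saturation_of X S"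
  unfolding saturation_of_def by auto

lemma saturation_of_mono: "S \<subseteq> T \<Longrightarrow> saturation_of X S \<subseteq> saturation_of X T"
  unfolding saturation_of_def by fastforce

lemma saturated_in_iff: "saturated_in X S \<longleftrightarrow> S \<subseteq> topspace X \<and> saturation_of X S \<subseteq> S"
  using subset_saturation_of[of S X]
  unfolding saturated_in_def saturation_of_def[symmetric] by (metis order_refl subset_antisym)

lemma saturated_inD:
  assumes "saturated_in X S" "x \<in> topspace X" "x \<notin> S"
  obtains U where "openin X U" "S \<subseteq> U" "x \<notin> U"
proof -
  have "x \<notin> saturation_of X S" using assms by (auto simp: saturated_in_iff)
  then show thesis using assms(2) that by (auto simp: saturation_of_def)
qed

lemma saturated_in_Int:
  assumes "saturated_in X S" "saturated_in X T"
  shows "saturated_in X (S \<inter> T)"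
  using assms saturation_of_mono[of "S \<inter> T" S X] saturation_of_mono[of "S \<inter> T" T X]
  unfolding saturated_in_iff by auto

lemma saturated_in_saturation_of: "saturated_in X (saturation_of X S)"
  unfolding saturated_in_iff by (auto simp: saturation_of_def)

text \<open>A set inside the space and its saturation lie in the same open sets, and the union of a
  finite subfamily is open; hence a finite subfamily that covers \<open>S\<close> covers its
  saturation.\<close>

lemma compactin_saturation_of:
  assumes S: "compactin X S"
  shows "compactin X (saturation_of X S)"
  unfolding compactin_def
proof (intro conjI allI impI)
  show "saturation_of X S \<subseteq> topspace X" by (auto simp: saturation_of_def)
  fix \<U> assume U: "Ball \<U> (openin X) \<and> saturation_of X S \<subseteq> \<Union> \<U>"
  have "S \<subseteq> \<Union>\<U>"
    using U subset_saturation_of[OF compactin_subset_topspace[OF S]] by blast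
  then obtain \<F> where F: "finite \<F>" "\<F> \<subseteq> \<U>" "S \<subseteq> \<Union>\<F>"
    using S U unfolding compactin_def by meson
  have "openin X (\<Union>\<F>)" using F U by auto
  then have "saturation_of X S \<subseteq> \<Union>\<F>" using F by (intro saturation_of_subset_open)
  with F show "\<exists>\<F>. finite \<F> \<and> \<F> \<subseteq> \<U> \<and> saturation_of X S \<subseteq> \<Union> \<F>"
    by (intro exI[of _ \<F>] conjI)
qed

text \<open>The preimage of an open neighbourhood of \<open>T\<close> is an open neighbourhood of
  \<open>S\<close>. Later \<open>f\<close> is a bonding map and \<open>S\<close>, \<open>T\<close>
  are images of one subset of the limit, so that saturated images again form a compatible
  family.\<close>

lemma image_saturation_of:
  assumes f: "continuous_map X Y f" and S: "S \<subseteq> topspace X" and ST: "f ` S \<subseteq> T"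
  shows "f ` saturation_of X S \<subseteq> saturation_of Y T"
proof -
  have "f x \<in> V" if x: "x \<in> saturation_of X S" and V: "openin Y V" "T \<subseteq> V" for x V
  proof -
    have "openin X {u \<in> topspace X. f u \<in> V}"
      by (rule openin_continuous_map_preimage[OF f V(1)])
    moreover have "S \<subseteq> {u \<in> topspace X. f u \<in> V}" using V S ST by blast
    ultimately show ?thesis using x saturation_of_subset_open by blast
  qed
  moreover have "f x \<in> topspace Y" if "x \<in> saturation_of X S" for x
    using that continuous_map_image_subset_topspace[OF f] by (auto simp: saturation_of_def)
  ultimately show ?thesis unfolding saturation_of_def[of Y] by blast
qed

section \<open>Irreducibility and sobriety in terms of open sets\<close>

text \<open>Pass to complements: two closed sets that cover \<open>C\<close> become two open sets
  with no common point in \<open>C\<close>.\<close>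

lemma irreducible_closed_in_iff_open:
  "irreducible_closed_in X C \<longleftrightarrow> C \<subseteq> topspace X \<and> openin X (topspace X - C) \<and> C \<noteq> {} \<and>
     (\<forall>A B. openin X A \<and> openin X B \<and> A \<inter> B \<inter> C = {} \<longrightarrow> A \<inter> C = {} \<or> B \<inter> C = {})"
  (is "_ \<longleftrightarrow> ?R")
proof
  assume C: "irreducible_closed_in X C"
  then have CX: "closedin X C" "C \<subseteq> topspace X" "C \<noteq> {}"
    using closedin_subset unfolding irreducible_closed_in_def by auto
  have "A \<inter> C = {} \<or> B \<inter> C = {}" if AB: "openin X A" "openin X B" "A \<inter> B \<inter> C = {}" for A B
  proof -
    have "closedin X (topspace X - A)" "closedin X (topspace X - B)" using AB by auto
    moreover have "C \<subseteq> (topspace X - A) \<union> (topspace X - B)" using AB CX by blast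
    ultimately have "C \<subseteq> topspace X - A \<or> C \<subseteq> topspace X - B"
      using C unfolding irreducible_closed_in_def by blast
    then show ?thesis by blast
  qed
  with CX show ?R by (auto simp: closedin_def)
next
  assume R: ?R
  have "C \<subseteq> A \<or> C \<subseteq> B" if AB: "closedin X A" "closedin X B" "C \<subseteq> A \<union> B" for A B
  proof -
    have "openin X (topspace X - A)" "openin X (topspace X - B)" using AB by auto
    moreover have "(topspace X - A) \<inter> (topspace X - B) \<inter> C = {}" using AB by blast
    ultimately have "(topspace X - A) \<inter> C = {} \<or> (topspace X - B) \<inter> C = {}" using R by blast
    then show ?thesis using R by blast
  qed
  with R show "irreducible_closed_in X C"
    by (auto simp: irreducible_closed_in_def closedin_def)
qed

text \<open>A closed set is determined by the open sets that it meets, and an open set meets the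
  closure of \<open>{x}\<close> exactly when it contains \<open>x\<close>.\<close>

lemma closure_of_singleton_eq_iff:
  assumes x: "x \<in> topspace X" and C: "closedin X C"
  shows "C = X closure_of {x} \<longleftrightarrow> (\<forall>V. openin X V \<longrightarrow> (V \<inter> C = {} \<longleftrightarrow> x \<notin> V))"
proof
  assume "C = X closure_of {x}"
  then show "\<forall>V. openin X V \<longrightarrow> (V \<inter> C = {} \<longleftrightarrow> x \<notin> V)"
    using openin_Int_closure_of_eq_empty[of X _ "{x}"] by auto
next
  assume R: "\<forall>V. openin X V \<longrightarrow> (V \<inter> C = {} \<longleftrightarrow> x \<notin> V)"
  have "openin X (topspace X - C)" using C by blast
  with R x have "x \<in> C" by blast
  with C have "X closure_of {x} \<subseteq> C" by (simp add: closure_of_minimal)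
  moreover have "C \<subseteq> X closure_of {x}"
    using R closedin_subset[OF C] by (fastforce simp: in_closure_of)
  ultimately show "C = X closure_of {x}" by blast
qed

text \<open>Sobriety in terms of opens: every meet-prime open is the largest open missing some point.\<close>

lemma sober_space_iff:
  "sober_space X \<longleftrightarrow> t0_space X \<and>
     (\<forall>W. openin X W \<and> W \<noteq> topspace X \<and>
        (\<forall>A B. openin X A \<and> openin X B \<and> A \<inter> B \<subseteq> W \<longrightarrow> A \<subseteq> W \<or> B \<subseteq> W)
      \<longrightarrow> (\<exists>x\<in>topspace X. \<forall>V. openin X V \<longrightarrow> (V \<subseteq> W \<longleftrightarrow> x \<notin> V)))"
  (is "_ \<longleftrightarrow> _ \<and> ?R")
proof -
  have meets: "V \<inter> (topspace X - W) = {} \<longleftrightarrow> V \<subseteq> W" if "openin X V" for V W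
    using openin_subset[OF that] by blast
  have meets2: "A \<inter> B \<inter> (topspace X - W) = {} \<longleftrightarrow> A \<inter> B \<subseteq> W" if "openin X A" for A B W
    using openin_subset[OF that] by blast
  have irr: "irreducible_closed_in X (topspace X - W) \<longleftrightarrow> W \<noteq> topspace X \<and>
      (\<forall>A B. openin X A \<and> openin X B \<and> A \<inter> B \<subseteq> W \<longrightarrow> A \<subseteq> W \<or> B \<subseteq> W)"
    if W: "openin X W" for W
  proof -
    have "topspace X - (topspace X - W) = W" using openin_subset[OF W] by blast
    then show ?thesis
      unfolding irreducible_closed_in_iff_open
      using W openin_subset[OF W] by (auto simp: meets meets2 cong: conj_cong)
  qed
  have pt: "topspace X - W = X closure_of {x} \<longleftrightarrow> (\<forall>V. openin X V \<longrightarrow> (V \<subseteq> W \<longleftrightarrow> x \<notin> V))"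
    if "openin X W" "x \<in> topspace X" for W x
    using closure_of_singleton_eq_iff[OF that(2), of "topspace X - W"] that(1)
    by (simp add: meets openin_closedin_eq)
  \<comment> \<open>Complementation turns the quantifier over irreducible closed sets into one over
    open sets \<open>W\<close>, to which \<open>irr\<close> and \<open>pt\<close> apply.\<close>
  have compl: "(\<forall>C. irreducible_closed_in X C \<longrightarrow> P C) \<longleftrightarrow>
      (\<forall>W. openin X W \<and> irreducible_closed_in X (topspace X - W) \<longrightarrow> P (topspace X - W))" for P
  proof (intro iffI allI impI)
    fix C assume P: "\<forall>W. openin X W \<and> irreducible_closed_in X (topspace X - W) \<longrightarrow> P (topspace X - W)"
      and C: "irreducible_closed_in X C"
    then have "closedin X C" by (simp add: irreducible_closed_in_def)
    then have "openin X (topspace X - C)" "topspace X - (topspace X - C) = C"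
      using closedin_subset by (blast, blast)
    with P C show "P C" by metis
  qed blast
  show ?thesis
    unfolding sober_space_def compl using irr pt by (simp cong: conj_cong bex_cong)
qed

lemma sober_spaceD:
  assumes "sober_space X" "openin X W" "W \<noteq> topspace X"
    and "\<And>A B. openin X A \<Longrightarrow> openin X B \<Longrightarrow> A \<inter> B \<subseteq> W \<Longrightarrow> A \<subseteq> W \<or> B \<subseteq> W"
  shows "\<exists>x\<in>topspace X. \<forall>V. openin X V \<longrightarrow> (V \<subseteq> W \<longleftrightarrow> x \<notin> V)"
  by (rule assms(1)[unfolded sober_space_iff, THEN conjunct2, rule_format])
    (use assms(2-4) in simp)

lemma t0_space_eqI:
  assumes "t0_space X" "x \<in> topspace X" "y \<in> topspace X" "\<And>V. openin X V \<Longrightarrow> x \<in> V \<longleftrightarrow> y \<in> V"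
  shows "x = y"
  using assms unfolding t0_space_def by blast

section \<open>Projective systems and their limits\<close>

locale projective_limit =
  fixes I :: "'i set" and le :: "'i \<Rightarrow> 'i \<Rightarrow> bool"
    and X :: "'i \<Rightarrow> 'a topology" and p :: "'i \<Rightarrow> 'i \<Rightarrow> 'a \<Rightarrow> 'a"
    and L :: "'b topology" and q :: "'i \<Rightarrow> 'b \<Rightarrow> 'a"
  assumes system: "projective_system I le X p"
    and limit: "is_proj_limit I le X p L q"
begin

lemma index_nonempty: "I \<noteq> {}"
  and index_refl: "i \<in> I \<Longrightarrow> le i i"
  and index_trans: "i \<in> I \<Longrightarrow> j \<in> I \<Longrightarrow> k \<in> I \<Longrightarrow> le i j \<Longrightarrow> le j k \<Longrightarrow> le i k"
  and bonding_continuous: "i \<in> I \<Longrightarrow> j \<in> I \<Longrightarrow> le i j \<Longrightarrow> continuous_map (X j) (X i) (p i j)"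
  and bonding_comp: "i \<in> I \<Longrightarrow> j \<in> I \<Longrightarrow> k \<in> I \<Longrightarrow> le i j \<Longrightarrow> le j k \<Longrightarrow> x \<in> topspace (X k)
    \<Longrightarrow> p i j (p j k x) = p i k x"
  using system unfolding projective_system_def directed_preorder_def by blast+

lemma index_directed:
  assumes "i \<in> I" "j \<in> I"
  obtains k where "k \<in> I" "le i k" "le j k"
  using system assms unfolding projective_system_def directed_preorder_def by meson

lemma index_finite_upper_bound:
  assumes "finite F" "F \<subseteq> I"
  shows "\<exists>k\<in>I. \<forall>i\<in>F. le i k"
  using assms
proof (induction F)
  case empty
  then show ?case using index_nonempty by blast
next
  case (insert a F)
  then obtain k where k: "k \<in> I" "\<forall>i\<in>F. le i k" by auto
  obtain m where "m \<in> I" "le a m" "le k m" using index_directed insert.prems k by blast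
  then show ?case using k insert.prems index_trans by (intro bexI[of _ m]) blast+
qed

lemma bonding_in_topspace:
  "i \<in> I \<Longrightarrow> j \<in> I \<Longrightarrow> le i j \<Longrightarrow> x \<in> topspace (X j) \<Longrightarrow> p i j x \<in> topspace (X i)"
  using continuous_map_image_subset_topspace[OF bonding_continuous] by blast

lemma bonding_preimage_open:
  "i \<in> I \<Longrightarrow> j \<in> I \<Longrightarrow> le i j \<Longrightarrow> openin (X i) V \<Longrightarrow> openin (X j) {x \<in> topspace (X j). p i j x \<in> V}"
  by (rule openin_continuous_map_preimage[OF bonding_continuous])

lemma proj_continuous: "i \<in> I \<Longrightarrow> continuous_map L (X i) (q i)"
  using limit by (simp add: is_proj_limit_def)

lemma proj_in_topspace: "i \<in> I \<Longrightarrow> y \<in> topspace L \<Longrightarrow> q i y \<in> topspace (X i)"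
  using continuous_map_image_subset_topspace[OF proj_continuous] by blast

lemma proj_preimage_open: "i \<in> I \<Longrightarrow> openin (X i) V \<Longrightarrow> openin L {y \<in> topspace L. q i y \<in> V}"
  by (rule openin_continuous_map_preimage[OF proj_continuous])

lemma bonding_proj: "i \<in> I \<Longrightarrow> j \<in> I \<Longrightarrow> le i j \<Longrightarrow> y \<in> topspace L \<Longrightarrow> p i j (q j y) = q i y"
  using limit by (simp add: is_proj_limit_def)

text \<open>This is surjectivity of the comparison map. Together with \<open>limit_separated\<close>
  (injectivity) and \<open>limit_basis\<close> (the topology) it replaces the canonical limit in all
  later arguments.\<close>

lemma limit_point_exists:
  assumes "\<And>i. i \<in> I \<Longrightarrow> x i \<in> topspace (X i)"
    and "\<And>i j. i \<in> I \<Longrightarrow> j \<in> I \<Longrightarrow> le i j \<Longrightarrow> p i j (x j) = x i"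
  obtains y where "y \<in> topspace L" "\<And>i. i \<in> I \<Longrightarrow> q i y = x i"
proof -
  have "restrict x I \<in> topspace (canonical_proj_limit I le X p)"
    using assms by (auto simp: canonical_proj_limit_def)
  also have "\<dots> = (\<lambda>y. restrict (\<lambda>i. q i y) I) ` topspace L"
    using limit homeomorphic_imp_surjective_map unfolding is_proj_limit_def by blast
  finally obtain y where "y \<in> topspace L" "restrict x I = restrict (\<lambda>i. q i y) I" by blast
  then show thesis using that by (metis restrict_apply')
qed

lemma limit_separated:
  assumes "y \<in> topspace L" "z \<in> topspace L" "y \<noteq> z"
  obtains i where "i \<in> I" "q i y \<noteq> q i z"
proof -
  have "inj_on (\<lambda>y. restrict (\<lambda>i. q i y) I) (topspace L)"
    using limit homeomorphic_imp_injective_map unfolding is_proj_limit_def by blast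
  then have "restrict (\<lambda>i. q i y) I \<noteq> restrict (\<lambda>i. q i z) I"
    using assms unfolding inj_on_def by blast
  then show thesis using that by (metis restrict_ext)
qed

text \<open>A basic open set of the product constrains finitely many coordinates. By directedness
  these constraints can be pulled back to one index above all of them, so preimages under single
  projections already form a base.\<close>

lemma limit_basis:
  assumes U: "openin L U" and y: "y \<in> U"
  obtains i V where "i \<in> I" "openin (X i) V" "q i y \<in> V" "{z \<in> topspace L. q i z \<in> V} \<subseteq> U"
proof -
  let ?f = "\<lambda>y. restrict (\<lambda>i. q i y) I"
  let ?T = "{x \<in> topspace (product_topology X I). \<forall>i\<in>I. \<forall>j\<in>I. le i j \<longrightarrow> p i j (x j) = x i}"
  have hom: "homeomorphic_map L (canonical_proj_limit I le X p) ?f"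
    using limit by (simp add: is_proj_limit_def)
  have UL: "U \<subseteq> topspace L" using U openin_subset by blast
  have "openin (canonical_proj_limit I le X p) (?f ` U)"
    using hom U homeomorphic_map_openness_eq by blast
  then obtain S where S: "openin (product_topology X I) S" "?f ` U = S \<inter> ?T"
    unfolding canonical_proj_limit_def openin_subtopology by blast
  have "?f y \<in> S" using S y by blast
  with S(1) have "\<exists>G. finite {i \<in> I. G i \<noteq> topspace (X i)} \<and> (\<forall>i\<in>I. openin (X i) (G i)) \<and>
      ?f y \<in> Pi\<^sub>E I G \<and> Pi\<^sub>E I G \<subseteq> S"
    unfolding openin_product_topology_alt by (rule bspec)
  then obtain G where G: "finite {i \<in> I. G i \<noteq> topspace (X i)}" "\<And>i. i \<in> I \<Longrightarrow> openin (X i) (G i)"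
      "?f y \<in> Pi\<^sub>E I G" "Pi\<^sub>E I G \<subseteq> S"
    by blast
  define F where "F = {i \<in> I. G i \<noteq> topspace (X i)}"
  obtain k where k: "k \<in> I" "\<forall>i\<in>F. le i k"
    using index_finite_upper_bound[of F] G(1) by (auto simp: F_def)
  \<comment> \<open>All constraints are collected at \<open>k\<close>; intersecting with
    \<open>topspace (X k)\<close> covers the case that \<open>F\<close> is empty.\<close>
  define V where "V = topspace (X k) \<inter> (\<Inter>i\<in>F. {x \<in> topspace (X k). p i k x \<in> G i})"
  have FI: "F \<subseteq> I" by (auto simp: F_def)
  have V: "openin (X k) V"
    unfolding V_def using G(1,2) k FI
    by (intro openin_Int_Inter) (auto simp: F_def[symmetric] bonding_preimage_open)
  have yL: "y \<in> topspace L" using UL y by blast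
  have "q i y \<in> G i" if "i \<in> I" for i using G(3) that by (auto simp: PiE_iff)
  then have "q k y \<in> V"
    using k FI yL by (auto simp: V_def bonding_proj proj_in_topspace subset_iff)
  moreover have "z \<in> U" if z: "z \<in> topspace L" "q k z \<in> V" for z
  proof -
    have "q i z \<in> G i" if "i \<in> I" for i
    proof (cases "i \<in> F")
      case True
      then show ?thesis using z k that by (auto simp: V_def bonding_proj)
    next
      case False
      then show ?thesis using z that by (auto simp: F_def proj_in_topspace)
    qed
    then have "?f z \<in> S" using G(4) by (auto simp: PiE_iff)
    moreover have "?f z \<in> ?T" using z by (auto simp: proj_in_topspace bonding_proj)
    ultimately have "?f z \<in> ?f ` U" using S(2) by blast
    then show "z \<in> U"
      using homeomorphic_imp_injective_map[OF hom] z(1) UL by (auto dest: inj_onD)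
  qed
  ultimately show thesis using that k(1) V by blast
qed

section \<open>Sobriety of the limit\<close>

text \<open>A meet-prime open \<open>W\<close> of the limit induces a meet-prime open in every
  \<open>X i\<close>, because preimages commute with intersections. The points that these determine
  are compatible, and the resulting point of the limit represents \<open>W\<close>.\<close>

lemma sober_limit:
  assumes sober: "\<And>i. i \<in> I \<Longrightarrow> sober_space (X i)"
  shows "sober_space L"
  unfolding sober_space_iff
proof (intro conjI allI impI)
  have t0: "t0_space (X i)" if "i \<in> I" for i using sober[OF that] by (simp add: sober_space_def)
  show "t0_space L"
    unfolding t0_space_def
  proof (intro ballI impI)
    fix y z assume yz: "y \<in> topspace L" "z \<in> topspace L" "y \<noteq> z"
    then obtain i where i: "i \<in> I" "q i y \<noteq> q i z" by (rule limit_separated)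
    then obtain V where "openin (X i) V" "q i y \<in> V \<longleftrightarrow> q i z \<notin> V"
      using t0 yz proj_in_topspace t0_space_eqI by metis
    with i yz show "\<exists>U. openin L U \<and> (y \<notin> U \<longleftrightarrow> z \<in> U)"
      by (intro exI[of _ "{u \<in> topspace L. q i u \<in> V}"]) (auto simp: proj_preimage_open)
  qed
  fix W
  assume W': "openin L W \<and> W \<noteq> topspace L \<and>
    (\<forall>A B. openin L A \<and> openin L B \<and> A \<inter> B \<subseteq> W \<longrightarrow> A \<subseteq> W \<or> B \<subseteq> W)"
  then have W: "openin L W" "\<not> topspace L \<subseteq> W"
    using openin_subset[of L W] by auto
  have prime: "A \<subseteq> W \<or> B \<subseteq> W" if "openin L A" "openin L B" "A \<inter> B \<subseteq> W" for A B
    using W' that by simp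
  define pre where "pre = (\<lambda>i V. {y \<in> topspace L. q i y \<in> V})"
  have "\<exists>x\<in>topspace (X i). \<forall>V. openin (X i) V \<longrightarrow> (pre i V \<subseteq> W \<longleftrightarrow> x \<notin> V)" if i: "i \<in> I" for i
  proof -
    \<comment> \<open>\<open>D\<close> is the largest open set of \<open>X i\<close> whose preimage
      in the limit lies in \<open>W\<close>.\<close>
    define D where "D = \<Union>{V. openin (X i) V \<and> pre i V \<subseteq> W}"
    have D: "V \<subseteq> D \<longleftrightarrow> pre i V \<subseteq> W" if "openin (X i) V" for V
      using that by (auto simp: D_def pre_def)
    have "openin (X i) D" by (auto simp: D_def)
    moreover have "D \<noteq> topspace (X i)"
      using D[of "topspace (X i)"] W(2) proj_in_topspace[OF i] by (auto simp: pre_def)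
    moreover have "A \<subseteq> D \<or> B \<subseteq> D" if AB: "openin (X i) A" "openin (X i) B" "A \<inter> B \<subseteq> D" for A B
    proof -
      have "pre i A \<inter> pre i B \<subseteq> W" using D[of "A \<inter> B"] AB by (auto simp: pre_def)
      then show ?thesis
        using prime[of "pre i A" "pre i B"] AB D proj_preimage_open[OF i] by (simp add: pre_def)
    qed
    ultimately have "\<exists>x\<in>topspace (X i). \<forall>V. openin (X i) V \<longrightarrow> (V \<subseteq> D \<longleftrightarrow> x \<notin> V)"
      by (rule sober_spaceD[OF sober[OF i]])
    then show ?thesis by (simp add: D cong: conj_cong)
  qed
  then have "\<forall>i\<in>I. \<exists>x. x \<in> topspace (X i) \<and> (\<forall>V. openin (X i) V \<longrightarrow> (pre i V \<subseteq> W \<longleftrightarrow> x \<notin> V))"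
    by blast
  from bchoice[OF this] obtain x where x: "\<And>i. i \<in> I \<Longrightarrow> x i \<in> topspace (X i)"
    and gen: "\<And>i V. i \<in> I \<Longrightarrow> openin (X i) V \<Longrightarrow> pre i V \<subseteq> W \<longleftrightarrow> x i \<notin> V" by blast
  have "p i j (x j) = x i" if ij: "i \<in> I" "j \<in> I" "le i j" for i j
  proof (rule t0_space_eqI[OF t0])
    fix V assume V: "openin (X i) V"
    \<comment> \<open>Pulling \<open>V\<close> back to the limit directly or through
      \<open>X j\<close> gives the same set, so by \<open>gen\<close> the points
      \<open>p i j (x j)\<close> and \<open>x i\<close> lie in the same open sets.\<close>
    have "pre j {u \<in> topspace (X j). p i j u \<in> V} = pre i V"
      using ij by (auto simp: pre_def proj_in_topspace bonding_proj)
    then show "p i j (x j) \<in> V \<longleftrightarrow> x i \<in> V"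
      using gen[OF ij(1) V] gen[OF ij(2) bonding_preimage_open[OF ij V]] x[OF ij(2)] by auto
  qed (use ij x bonding_in_topspace in auto)
  then obtain y where y: "y \<in> topspace L" "\<And>i. i \<in> I \<Longrightarrow> q i y = x i"
    using limit_point_exists[of x] x by blast
  have "U \<subseteq> W \<longleftrightarrow> y \<notin> U" if U: "openin L U" for U
  proof
    assume UW: "U \<subseteq> W"
    show "y \<notin> U"
    proof
      assume "y \<in> U"
      then obtain i V where iV: "i \<in> I" "openin (X i) V" "q i y \<in> V" "pre i V \<subseteq> U"
        using limit_basis[OF U] unfolding pre_def by metis
      then show False using gen[of i V] UW y(2)[of i] by auto
    qed
  next
    assume yU: "y \<notin> U"
    show "U \<subseteq> W"
    proof
      fix z assume z: "z \<in> U"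
      then obtain i V where iV: "i \<in> I" "openin (X i) V" "q i z \<in> V" "pre i V \<subseteq> U"
        using limit_basis[OF U] unfolding pre_def by metis
      have "x i \<notin> V" using iV yU y by (auto simp: pre_def)
      then have "pre i V \<subseteq> W" using gen iV by blast
      then show "z \<in> W" using iV z openin_subset[OF U] by (auto simp: pre_def)
    qed
  qed
  then show "\<exists>x\<in>topspace L. \<forall>V. openin L V \<longrightarrow> (V \<subseteq> W \<longleftrightarrow> x \<notin> V)" using y by blast
qed

section \<open>Steenrod's theorem: limits of compact saturated sets\<close>

text \<open>Families \<open>(W\<^sub>i)\<close> of opens are encoded as subsets of \<open>'i \<times> 'a\<close>, so that Zorn's lemma applies to
  set inclusion.\<close>

definition open_family :: "('i \<times> 'a) set \<Rightarrow> bool" where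
  "open_family W \<longleftrightarrow> (\<forall>i\<in>I. openin (X i) (W `` {i})) \<and>
     (\<forall>i\<in>I. \<forall>j\<in>I. \<forall>x\<in>topspace (X j). le i j \<and> p i j x \<in> W `` {i} \<longrightarrow> x \<in> W `` {j})"

lemma open_familyI:
  assumes "\<And>i. i \<in> I \<Longrightarrow> openin (X i) (W `` {i})"
    and "\<And>i j x. i \<in> I \<Longrightarrow> j \<in> I \<Longrightarrow> le i j \<Longrightarrow> x \<in> topspace (X j) \<Longrightarrow> p i j x \<in> W `` {i}
      \<Longrightarrow> x \<in> W `` {j}"
  shows "open_family W"
  using assms unfolding open_family_def by simp

lemma open_family_open: "open_family W \<Longrightarrow> i \<in> I \<Longrightarrow> openin (X i) (W `` {i})"
  by (simp add: open_family_def)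

lemma open_familyD:
  "open_family W \<Longrightarrow> i \<in> I \<Longrightarrow> j \<in> I \<Longrightarrow> le i j \<Longrightarrow> x \<in> topspace (X j) \<Longrightarrow> p i j x \<in> W `` {i}
    \<Longrightarrow> x \<in> W `` {j}"
  unfolding open_family_def by blast

text \<open>This supplies upper bounds of chains for Zorn's lemma.\<close>

lemma open_family_Union:
  assumes \<C>: "\<And>W. W \<in> \<C> \<Longrightarrow> open_family W"
  shows "open_family (\<Union>\<C>)"
proof (rule open_familyI)
  fix i assume "i \<in> I"
  have "\<Union>\<C> `` {i} = \<Union>((\<lambda>W. W `` {i}) ` \<C>)" by blast
  also have "openin (X i) \<dots>"
    by (rule openin_Union) (use \<C> \<open>i \<in> I\<close> open_family_open in fast)
  finally show "openin (X i) (\<Union>\<C> `` {i})" .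
next
  fix i j x
  assume ij: "i \<in> I" "j \<in> I" "le i j" "x \<in> topspace (X j)" and x: "p i j x \<in> \<Union>\<C> `` {i}"
  from x obtain W where "W \<in> \<C>" "p i j x \<in> W `` {i}" by blast
  then show "x \<in> \<Union>\<C> `` {j}" using open_familyD[OF \<C> ij] by blast
qed

text \<open>Once \<open>A\<close> is added at \<open>i\<close>, compatibility forces its preimages
  to be added at all indices above \<open>i\<close>. Transitivity of \<open>le\<close> and the
  composition law show that nothing more is needed.\<close>

lemma open_family_generated:
  assumes W: "open_family W" and i: "i \<in> I" and A: "openin (X i) A"
  shows "open_family (W \<union> {(k, x). k \<in> I \<and> le i k \<and> x \<in> topspace (X k) \<and> p i k x \<in> A})"
    (is "open_family (W \<union> ?G)")
proof (rule open_familyI)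
  have G: "?G `` {k} = (if k \<in> I \<and> le i k then {x \<in> topspace (X k). p i k x \<in> A} else {})" for k
    by auto
  show "openin (X k) ((W \<union> ?G) `` {k})" if "k \<in> I" for k
    using open_family_open[OF W that] bonding_preimage_open[OF i that _ A]
    unfolding Un_Image G by auto
  fix j k x
  assume jk: "j \<in> I" "k \<in> I" "le j k" "x \<in> topspace (X k)" and "p j k x \<in> (W \<union> ?G) `` {j}"
  then consider "p j k x \<in> W `` {j}" | "le i j" "p i j (p j k x) \<in> A" by auto
  then show "x \<in> (W \<union> ?G) `` {k}"
  proof cases
    case 1
    then show ?thesis using open_familyD[OF W jk] by blast
  next
    case 2
    have "le i k" using index_trans[OF i jk(1,2) 2(1) jk(3)] .
    moreover have "p i k x \<in> A" using bonding_comp[OF i jk(1,2) 2(1) jk(3,4)] 2(2) by simp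
    ultimately show ?thesis using jk by auto
  qed
qed

text \<open>Passing to a maximal family makes each complement the closure of a point.\<close>

lemma point_outside_open_family:
  assumes sober: "\<And>i. i \<in> I \<Longrightarrow> sober_space (X i)"
    and Qc: "\<And>i. i \<in> I \<Longrightarrow> compactin (X i) (Q i)"
    and Qs: "\<And>i. i \<in> I \<Longrightarrow> saturated_in (X i) (Q i)"
    and Qp: "\<And>i j. i \<in> I \<Longrightarrow> j \<in> I \<Longrightarrow> le i j \<Longrightarrow> p i j ` Q j \<subseteq> Q i"
    and W0: "open_family W0" "\<And>i. i \<in> I \<Longrightarrow> \<not> Q i \<subseteq> W0 `` {i}"
  obtains y where "y \<in> topspace L" "\<And>i. i \<in> I \<Longrightarrow> q i y \<in> Q i" "\<And>i. i \<in> I \<Longrightarrow> q i y \<notin> W0 `` {i}"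
proof -
  define \<A> where "\<A> = {W. open_family W \<and> (\<forall>i\<in>I. \<not> Q i \<subseteq> W `` {i}) \<and> W0 \<subseteq> W}"
  have "\<exists>M\<in>\<A>. \<forall>W\<in>\<A>. M \<subseteq> W \<longrightarrow> W = M"
  proof (rule subset_Zorn_nonempty)
    show "\<A> \<noteq> {}" using W0 by (auto simp: \<A>_def)
    fix \<C> assume ne: "\<C> \<noteq> {}" and chain: "subset.chain \<A> \<C>"
    then have sub: "\<C> \<subseteq> \<A>" by (simp add: subset_chain_def)
    \<comment> \<open>By compactness finitely many members of the chain would already cover
      \<open>Q i\<close>, and the largest of them would do so alone, contrary to its membership in
      \<open>\<A>\<close>.\<close>
    have "\<not> Q i \<subseteq> \<Union>\<C> `` {i}" if i: "i \<in> I" for i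
    proof
      assume "Q i \<subseteq> \<Union>\<C> `` {i}"
      then have "Q i \<subseteq> \<Union>((\<lambda>W. W `` {i}) ` \<C>)" by blast
      moreover have "\<And>U. U \<in> (\<lambda>W. W `` {i}) ` \<C> \<Longrightarrow> openin (X i) U"
        using sub i by (auto simp: \<A>_def open_family_open)
      ultimately obtain \<F> where F: "finite \<F>" "\<F> \<subseteq> (\<lambda>W. W `` {i}) ` \<C>" "Q i \<subseteq> \<Union>\<F>"
        using Qc[OF i] unfolding compactin_def by meson
      then obtain \<D> where D: "finite \<D>" "\<D> \<subseteq> \<C>" "\<F> = (\<lambda>W. W `` {i}) ` \<D>"
        by (meson finite_subset_image)
      have "\<exists>W\<in>\<C>. \<Union>\<D> \<subseteq> W"
        using D(1,2)
      proof (induction \<D>)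
        case empty
        then show ?case using ne by blast
      next
        case (insert V \<D>)
        then obtain W where "W \<in> \<C>" "\<Union>\<D> \<subseteq> W" by auto
        moreover from this have "V \<subseteq> W \<or> W \<subseteq> V"
          using chain insert.prems by (simp add: subset_chain_def)
        ultimately show ?case using insert.prems by auto
      qed
      then obtain W where "W \<in> \<C>" "\<Union>\<D> \<subseteq> W" by (elim bexE)
      then have "\<Union>\<F> \<subseteq> W `` {i}" unfolding D(3) by blast
      with F(3) have "Q i \<subseteq> W `` {i}" by simp
      then show False using \<open>W \<in> \<C>\<close> sub i by (auto simp: \<A>_def)
    qed
    moreover have "open_family (\<Union>\<C>)" using sub by (intro open_family_Union) (auto simp: \<A>_def)
    moreover have "W0 \<subseteq> \<Union>\<C>" using ne sub by (auto simp: \<A>_def)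
    ultimately show "\<Union>\<C> \<in> \<A>" by (simp add: \<A>_def)
  qed
  then obtain M where M\<A>: "M \<in> \<A>" and max: "\<And>W. W \<in> \<A> \<Longrightarrow> M \<subseteq> W \<Longrightarrow> W = M" by auto
  then have M: "open_family M" "\<And>i. i \<in> I \<Longrightarrow> \<not> Q i \<subseteq> M `` {i}" "W0 \<subseteq> M"
    by (auto simp: \<A>_def)
  have QX: "Q i \<subseteq> topspace (X i)" if "i \<in> I" for i
    using Qc[OF that] by (rule compactin_subset_topspace)
  \<comment> \<open>If \<open>A\<close> is not contained in the section of \<open>M\<close> at
    \<open>i\<close>, then adding \<open>A\<close> gives a strictly larger family, which by
    maximality contains some \<open>Q k\<close>. Here \<open>k\<close> lies above \<open>i\<close>,
    since nothing is added at other indices. As bonding maps send \<open>Q n\<close> into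
    \<open>Q k\<close>, the covering persists at all \<open>n\<close> above
    \<open>k\<close>.\<close>
  have ev: "\<exists>k\<in>I. le i k \<and> (\<forall>n\<in>I. le k n \<longrightarrow> Q n \<subseteq> M `` {n} \<union> {x. p i n x \<in> A})"
    if i: "i \<in> I" and A: "openin (X i) A" and nA: "\<not> A \<subseteq> M `` {i}" for i A
  proof -
    let ?G = "{(k, x). k \<in> I \<and> le i k \<and> x \<in> topspace (X k) \<and> p i k x \<in> A}"
    have "M \<union> ?G \<noteq> M"
    proof -
      obtain a where a: "a \<in> A" "(i, a) \<notin> M" using nA by blast
      moreover have "a \<in> topspace (X i)" using a openin_subset[OF A] by blast
      moreover have "p i i a = a"
        using system i \<open>a \<in> topspace (X i)\<close> unfolding projective_system_def by blast
      ultimately have "(i, a) \<in> ?G" using i index_refl by auto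
      with a show ?thesis by blast
    qed
    then have "M \<union> ?G \<notin> \<A>" using max[of "M \<union> ?G"] by blast
    then obtain k where k: "k \<in> I" "Q k \<subseteq> (M \<union> ?G) `` {k}"
      using open_family_generated[OF M(1) i A] M(3) unfolding \<A>_def by blast
    have ik: "le i k" using k M(2)[OF k(1)] by blast
    have "x \<in> M `` {n} \<union> {x. p i n x \<in> A}" if n: "n \<in> I" "le k n" "x \<in> Q n" for n x
    proof -
      have xX: "x \<in> topspace (X n)" using QX n by blast
      have "p k n x \<in> Q k" using Qp[OF k(1) n(1,2)] n(3) by blast
      then have "p k n x \<in> M `` {k} \<or> p i k (p k n x) \<in> A" using k(2) by blast
      then show ?thesis
        using open_familyD[OF M(1) k(1) n(1,2) xX] bonding_comp[OF i k(1) n(1) ik n(2) xX] by auto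
    qed
    with k(1) ik show ?thesis by blast
  qed
  \<comment> \<open>Sobriety applies once the section of \<open>M\<close> at \<open>i\<close> is
    shown to be meet-prime; \<open>x\<close> is then the generic point of its complement.\<close>
  have "\<exists>x\<in>topspace (X i). \<forall>V. openin (X i) V \<longrightarrow> (V \<subseteq> M `` {i} \<longleftrightarrow> x \<notin> V)" if i: "i \<in> I" for i
  proof -
    have "M `` {i} \<noteq> topspace (X i)" using M(2)[OF i] QX[OF i] by blast
    moreover have "A \<subseteq> M `` {i} \<or> B \<subseteq> M `` {i}"
      if AB: "openin (X i) A" "openin (X i) B" "A \<inter> B \<subseteq> M `` {i}" for A B
    proof (rule ccontr)
      assume "\<not> ?thesis"
      then obtain k m where k: "k \<in> I" "le i k" "\<forall>n\<in>I. le k n \<longrightarrow> Q n \<subseteq> M `` {n} \<union> {x. p i n x \<in> A}"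
        and m: "m \<in> I" "le i m" "\<forall>n\<in>I. le m n \<longrightarrow> Q n \<subseteq> M `` {n} \<union> {x. p i n x \<in> B}"
        using ev[OF i AB(1)] ev[OF i AB(2)] by blast
      obtain n where n: "n \<in> I" "le k n" "le m n" using index_directed k(1) m(1) by blast
      have "le i n" using index_trans i k n by blast
      \<comment> \<open>A point of \<open>Q n\<close> outside the section of \<open>M\<close> at
        \<open>n\<close> would be sent by \<open>p i n\<close> into both \<open>A\<close> and
        \<open>B\<close>, hence into the section at \<open>i\<close>; compatibility of
        \<open>M\<close> excludes this.\<close>
      have "Q n \<subseteq> M `` {n}"
      proof
        fix x assume x: "x \<in> Q n"
        then have "x \<in> topspace (X n)" using QX n by blast
        moreover have "x \<in> M `` {n} \<or> p i n x \<in> M `` {i}" using k(3) m(3) n x AB(3) by blast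
        ultimately show "x \<in> M `` {n}" using open_familyD[OF M(1) i n(1) \<open>le i n\<close>] by blast
      qed
      then show False using M(2) n by blast
    qed
    ultimately show ?thesis
      by (rule sober_spaceD[OF sober[OF i] open_family_open[OF M(1) i]])
  qed
  then have "\<forall>i\<in>I. \<exists>x. x \<in> topspace (X i) \<and> (\<forall>V. openin (X i) V \<longrightarrow> (V \<subseteq> M `` {i} \<longleftrightarrow> x \<notin> V))"
    by blast
  from bchoice[OF this] obtain x where "\<forall>i\<in>I. x i \<in> topspace (X i) \<and>
      (\<forall>V. openin (X i) V \<longrightarrow> (V \<subseteq> M `` {i} \<longleftrightarrow> x i \<notin> V))"
    by (elim exE)
  then have x: "\<And>i. i \<in> I \<Longrightarrow> x i \<in> topspace (X i)"
    and gen: "\<And>i V. i \<in> I \<Longrightarrow> openin (X i) V \<Longrightarrow> V \<subseteq> M `` {i} \<longleftrightarrow> x i \<notin> V"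
    by simp_all
  have xM: "x i \<notin> M `` {i}" if "i \<in> I" for i
    using gen[OF that open_family_open[OF M(1) that]] by simp
  have "p i j (x j) = x i" if ij: "i \<in> I" "j \<in> I" "le i j" for i j
  proof (rule t0_space_eqI)
    show "t0_space (X i)" using sober[OF ij(1)] by (simp add: sober_space_def)
    fix A assume A: "openin (X i) A"
    show "p i j (x j) \<in> A \<longleftrightarrow> x i \<in> A"
    proof
      assume "p i j (x j) \<in> A"
      then have "\<not> A \<subseteq> M `` {i}" using open_familyD[OF M(1) ij x[OF ij(2)]] xM[OF ij(2)] by auto
      then show "x i \<in> A" using gen[OF ij(1) A] by simp
    next
      assume xA: "x i \<in> A"
      show "p i j (x j) \<in> A"
      proof (rule ccontr)
        assume "p i j (x j) \<notin> A"
        then have AM: "{u \<in> topspace (X j). p i j u \<in> A} \<subseteq> M `` {j}"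
          using gen[OF ij(2) bonding_preimage_open[OF ij A]] by blast
        have "\<not> A \<subseteq> M `` {i}" using gen A xA ij by blast
        then obtain k where k: "k \<in> I" "\<forall>n\<in>I. le k n \<longrightarrow> Q n \<subseteq> M `` {n} \<union> {x. p i n x \<in> A}"
          using ev[OF ij(1) A] by blast
        obtain n where n: "n \<in> I" "le k n" "le j n" using index_directed k(1) ij(2) by blast
        \<comment> \<open>A point of \<open>Q n\<close> that \<open>p i n\<close> sends into
          \<open>A\<close> is sent by \<open>p j n\<close> into the preimage of \<open>A\<close>,
          which \<open>AM\<close> places in the section at \<open>j\<close>. So either alternative
          from \<open>ev\<close> leads into the section at \<open>n\<close>.\<close>
        have "Q n \<subseteq> M `` {n}"
        proof
          fix u assume u: "u \<in> Q n"
          then have uX: "u \<in> topspace (X n)" using QX n by blast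
          have "p i n u \<in> A \<Longrightarrow> p j n u \<in> M `` {j}"
            using AM bonding_comp[OF ij(1,2) n(1) ij(3) n(3) uX]
              bonding_in_topspace[OF ij(2) n(1,3) uX] by auto
          then show "u \<in> M `` {n}"
            using k(2) n u open_familyD[OF M(1) ij(2) n(1,3) uX] by blast
        qed
        then show False using M(2) n by blast
      qed
    qed
  qed (use ij x bonding_in_topspace in auto)
  then obtain y where y: "y \<in> topspace L" "\<And>i. i \<in> I \<Longrightarrow> q i y = x i"
    using limit_point_exists[of x] x by blast
  \<comment> \<open>Saturation enters here: an open set that contains \<open>Q i\<close> and misses
    \<open>x i\<close> would lie in the section of \<open>M\<close> at \<open>i\<close>, which does
    not contain \<open>Q i\<close>.\<close>
  have "x i \<in> Q i" if i: "i \<in> I" for i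
  proof (rule ccontr)
    assume "x i \<notin> Q i"
    then obtain U where "openin (X i) U" "Q i \<subseteq> U" "x i \<notin> U"
      using saturated_inD[OF Qs[OF i] x[OF i]] by blast
    then show False using gen[OF i] M(2)[OF i] by blast
  qed
  moreover have "x i \<notin> W0 `` {i}" if "i \<in> I" for i using xM[OF that] M(3) by blast
  ultimately show thesis using that y by simp
qed

text \<open>If no finite subcover exists, \<open>point_outside_open_family\<close> yields a point of
  the limit set outside every open set with finitely covered preimage. But the cover contains a
  neighbourhood of that point, and a basic preimage inside this neighbourhood is covered by a single
  member.\<close>

lemma compactin_limit:
  assumes sober: "\<And>i. i \<in> I \<Longrightarrow> sober_space (X i)"
    and Qc: "\<And>i. i \<in> I \<Longrightarrow> compactin (X i) (Q i)"
    and Qs: "\<And>i. i \<in> I \<Longrightarrow> saturated_in (X i) (Q i)"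
    and Qp: "\<And>i j. i \<in> I \<Longrightarrow> j \<in> I \<Longrightarrow> le i j \<Longrightarrow> p i j ` Q j \<subseteq> Q i"
  shows "compactin L {y \<in> topspace L. \<forall>i\<in>I. q i y \<in> Q i}" (is "compactin L ?M")
  unfolding compactin_def
proof (intro conjI allI impI)
  fix \<U> assume U: "Ball \<U> (openin L) \<and> ?M \<subseteq> \<Union>\<U>"
  \<comment> \<open>\<open>fin S\<close> says that finitely many members of the cover suffice for
    \<open>S\<close>. Such sets are closed under subsets and finite unions.\<close>
  define fin where "fin = (\<lambda>S. \<exists>\<F>. finite \<F> \<and> \<F> \<subseteq> \<U> \<and> S \<subseteq> \<Union>\<F>)"
  have fin_mono: "fin S \<Longrightarrow> T \<subseteq> S \<Longrightarrow> fin T" for S T unfolding fin_def by blast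
  have fin_Union: "fin (\<Union>\<S>)" if "finite \<S>" "\<And>S. S \<in> \<S> \<Longrightarrow> fin S" for \<S>
    using that
  proof (induction \<S>)
    case empty
    then show ?case by (auto simp: fin_def)
  next
    case (insert S \<S>)
    then obtain \<F> \<G> where "finite \<F>" "\<F> \<subseteq> \<U>" "S \<subseteq> \<Union>\<F>" "finite \<G>" "\<G> \<subseteq> \<U>" "\<Union>\<S> \<subseteq> \<Union>\<G>"
      unfolding fin_def by (metis insertCI)
    then show ?case unfolding fin_def by (intro exI[of _ "\<F> \<union> \<G>"]) auto
  qed
  define pre where "pre = (\<lambda>i V. {y \<in> topspace L. q i y \<in> V})"
  define \<V> where "\<V> = (\<lambda>i. {V. openin (X i) V \<and> fin (pre i V)})"
  define W where "W = {(i, x). x \<in> \<Union>(\<V> i)}"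
  have W: "W `` {i} = \<Union>(\<V> i)" for i by (auto simp: W_def)
  have "fin ?M"
  proof (rule ccontr)
    assume nfin: "\<not> fin ?M"
    have "open_family W"
    proof (rule open_familyI, unfold W)
      show "openin (X i) (\<Union>(\<V> i))" for i by (auto simp: \<V>_def)
      fix i j x
      assume ij: "i \<in> I" "j \<in> I" "le i j" "x \<in> topspace (X j)" and "p i j x \<in> \<Union>(\<V> i)"
      then obtain V where V: "openin (X i) V" "fin (pre i V)" "p i j x \<in> V" by (auto simp: \<V>_def)
      let ?V = "{x \<in> topspace (X j). p i j x \<in> V}"
      have "pre j ?V \<subseteq> pre i V" using ij by (auto simp: pre_def bonding_proj)
      then have "?V \<in> \<V> j" using ij V fin_mono bonding_preimage_open by (auto simp: \<V>_def)
      then show "x \<in> \<Union>(\<V> j)" using ij V by blast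
    qed
    moreover have "\<not> Q i \<subseteq> W `` {i}" if i: "i \<in> I" for i
    proof
      assume "Q i \<subseteq> W `` {i}"
      then have "Q i \<subseteq> \<Union>(\<V> i)" by (simp add: W)
      moreover have "\<And>V. V \<in> \<V> i \<Longrightarrow> openin (X i) V" by (simp add: \<V>_def)
      ultimately obtain \<F> where F: "finite \<F>" "\<F> \<subseteq> \<V> i" "Q i \<subseteq> \<Union>\<F>"
        using Qc[OF i] unfolding compactin_def by meson
      have "fin (\<Union>(pre i ` \<F>))" using F by (intro fin_Union) (auto simp: \<V>_def)
      \<comment> \<open>Every point of the limit set projects into \<open>Q i\<close>, so a finite
        cover of \<open>Q i\<close> by members of \<open>\<V> i\<close> would make the whole limit
        set finitely covered.\<close>
      moreover have "?M \<subseteq> \<Union>(pre i ` \<F>)" using F(3) i by (auto simp: pre_def)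
      ultimately show False using nfin fin_mono by blast
    qed
    ultimately obtain y where y: "y \<in> topspace L" "\<And>i. i \<in> I \<Longrightarrow> q i y \<in> Q i"
        "\<And>i. i \<in> I \<Longrightarrow> q i y \<notin> W `` {i}"
      using point_outside_open_family[OF sober Qc Qs Qp] by blast
    then obtain G where G: "G \<in> \<U>" "openin L G" "y \<in> G" using U by blast
    then obtain i V where iV: "i \<in> I" "openin (X i) V" "q i y \<in> V" "pre i V \<subseteq> G"
      using limit_basis unfolding pre_def by metis
    have "fin (pre i V)" unfolding fin_def using G iV by (intro exI[of _ "{G}"]) auto
    then have "V \<in> \<V> i" using iV by (simp add: \<V>_def)
    then show False using y(3)[OF iV(1)] iV(3) by (auto simp: W)
  qed
  then show "\<exists>\<F>. finite \<F> \<and> \<F> \<subseteq> \<U> \<and> ?M \<subseteq> \<Union>\<F>" by (simp add: fin_def)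
qed blast

section \<open>Compact saturated subsets of the limit and coherence\<close>

text \<open>By compactness and directedness, between \<open>K\<close> and any open \<open>U\<close>
  containing it lies the preimage of one open set \<open>V\<close> of a single \<open>X k\<close>.
  Such a \<open>V\<close> contains the saturation of the image of \<open>K\<close>, so a point that
  projects into all these saturations lies in every such \<open>U\<close>.\<close>

lemma compact_saturated_eq_limit:
  assumes Kc: "compactin L K" and Ks: "saturated_in L K"
  shows "K = {y \<in> topspace L. \<forall>i\<in>I. q i y \<in> saturation_of (X i) (q i ` K)}" (is "_ = ?R")
proof
  have KL: "K \<subseteq> topspace L" using Kc by (rule compactin_subset_topspace)
  have img: "q i ` K \<subseteq> topspace (X i)" if "i \<in> I" for i using KL proj_in_topspace that by blast
  show "K \<subseteq> ?R" using KL subset_saturation_of[OF img] by blast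
  show "?R \<subseteq> K"
  proof
    fix y assume y: "y \<in> ?R"
    show "y \<in> K"
    proof (rule ccontr)
      assume "y \<notin> K"
      then obtain U where U: "openin L U" "K \<subseteq> U" "y \<notin> U"
        using saturated_inD[OF Ks] y by blast
      \<comment> \<open>Each basic open set is paired with its index, so that a finite subcover
        gives finitely many indices with a common upper bound.\<close>
      define B where "B = {(i, V). i \<in> I \<and> openin (X i) V \<and> {z \<in> topspace L. q i z \<in> V} \<subseteq> U}"
      define pre where "pre = (\<lambda>(i, V). {z \<in> topspace L. q i z \<in> V})"
      have "K \<subseteq> \<Union>(pre ` B)"
      proof
        fix z assume z: "z \<in> K"
        then obtain i V where "i \<in> I" "openin (X i) V" "q i z \<in> V" "{z \<in> topspace L. q i z \<in> V} \<subseteq> U"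
          using limit_basis[OF U(1)] U(2) by blast
        then have "(i, V) \<in> B" "z \<in> pre (i, V)" using z KL by (auto simp: B_def pre_def)
        then show "z \<in> \<Union>(pre ` B)" by blast
      qed
      moreover have "\<And>T. T \<in> pre ` B \<Longrightarrow> openin L T"
        by (auto simp: B_def pre_def proj_preimage_open)
      ultimately obtain \<F> where F: "finite \<F>" "\<F> \<subseteq> pre ` B" "K \<subseteq> \<Union>\<F>"
        using Kc unfolding compactin_def by meson
      then obtain D where D: "finite D" "D \<subseteq> B" "\<F> = pre ` D" by (meson finite_subset_image)
      have B: "fst d \<in> I" "openin (X (fst d)) (snd d)" if "d \<in> D" for d
        using that D(2) by (auto simp: B_def)
      then obtain k where k: "k \<in> I" "\<And>d. d \<in> D \<Longrightarrow> le (fst d) k"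
        using index_finite_upper_bound[of "fst ` D"] D(1) by fastforce
      \<comment> \<open>All chosen open sets are pulled back to \<open>X k\<close> and united there;
        the preimage of \<open>V\<close> in the limit is then exactly the union of the
        subcover.\<close>
      define V where "V = (\<Union>d\<in>D. {x \<in> topspace (X k). p (fst d) k x \<in> snd d})"
      have "openin (X k) V"
        unfolding V_def using k B by (intro openin_Union) (auto intro: bonding_preimage_open)
      moreover have preV: "q k z \<in> V \<longleftrightarrow> z \<in> \<Union>\<F>" if "z \<in> topspace L" for z
        using that k B by (simp add: V_def D(3) pre_def case_prod_beta proj_in_topspace bonding_proj)
      then have "q k ` K \<subseteq> V" using F(3) KL by blast
      ultimately have "q k y \<in> V" using y k(1) saturation_of_subset_open by blast
      then have "y \<in> \<Union>\<F>" using preV y by blast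
      also have "\<dots> \<subseteq> U" using D by (force simp: B_def pre_def)
      finally show False using U by blast
    qed
  qed
qed

text \<open>Coherence is applied at each index, where it makes the intersection of the two saturated
  images compact. Sobriety of the \<open>X i\<close> then carries compactness over to the limit
  through \<open>compactin_limit\<close>.\<close>

lemma coherent_limit:
  assumes sober: "\<And>i. i \<in> I \<Longrightarrow> sober_space (X i)"
    and coh: "\<And>i. i \<in> I \<Longrightarrow> coherent_space (X i)"
  shows "coherent_space L"
  unfolding coherent_space_def
proof (intro allI impI)
  fix K M assume KM: "compactin L K \<and> saturated_in L K \<and> compactin L M \<and> saturated_in L M"
  define sat where "sat = (\<lambda>S i. saturation_of (X i) (q i ` S))"
  have comp: "compactin (X i) (sat S i)" if "i \<in> I" "compactin L S" for i S
    unfolding sat_def using that image_compactin proj_continuous compactin_saturation_of by blast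
  have bond: "p i j ` sat S j \<subseteq> sat S i"
    if ij: "i \<in> I" "j \<in> I" "le i j" and S: "S \<subseteq> topspace L" for i j S
    unfolding sat_def
  proof (rule image_saturation_of[OF bonding_continuous[OF ij]])
    show "q j ` S \<subseteq> topspace (X j)" using S proj_in_topspace ij by blast
    show "p i j ` q j ` S \<subseteq> q i ` S" using S bonding_proj[OF ij] by force
  qed
  define Q where "Q = (\<lambda>i. sat K i \<inter> sat M i)"
  have "compactin L {y \<in> topspace L. \<forall>i\<in>I. q i y \<in> Q i}"
  proof (rule compactin_limit[OF sober])
    show "compactin (X i) (Q i)" if "i \<in> I" for i
      using coh[OF that] comp[OF that] KM saturated_in_saturation_of
      unfolding coherent_space_def Q_def sat_def by blast
    show "saturated_in (X i) (Q i)" for i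
      unfolding Q_def sat_def by (intro saturated_in_Int saturated_in_saturation_of)
    show "p i j ` Q j \<subseteq> Q i" if "i \<in> I" "j \<in> I" "le i j" for i j
      using bond[OF that] KM compactin_subset_topspace unfolding Q_def by blast
  qed
  moreover have "K \<inter> M = {y \<in> topspace L. \<forall>i\<in>I. q i y \<in> Q i}"
    using compact_saturated_eq_limit[of K] compact_saturated_eq_limit[of M] KM
    unfolding Q_def sat_def by blast
  ultimately show "compactin L (K \<inter> M)" by simp
qed

end

theorem theorem4p4:
  fixes I :: "'i set" and le :: "'i \<Rightarrow> 'i \<Rightarrow> bool"
    and X :: "'i \<Rightarrow> 'a topology" and p :: "'i \<Rightarrow> 'i \<Rightarrow> 'a \<Rightarrow> 'a"
    and L :: "'b topology" and q :: "'i \<Rightarrow> 'b \<Rightarrow> 'a"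
  assumes "projective_system I le X p"
    and "\<forall>i\<in>I. coherent_space (X i) \<and> sober_space (X i)"
    and "is_proj_limit I le X p L q"
  shows "coherent_space L \<and> sober_space L"
proof -
  interpret projective_limit I le X p L q using assms by unfold_locales
  show ?thesis using coherent_limit sober_limit assms(2) by blast
qed

end
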